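(* Fix $\alpha \in (0,\infty)$. Let $\varphi : [0,\infty) \to [-\infty,\infty]$ be a function such that $\mathrm{FDPD}_{\varphi,\alpha}$ is a valid divergence on $\mathcal{L}_{\mu,\alpha}$. Then the function $\psi : [-\infty,\infty) \to [-\infty,\infty]$ defined by $\psi(x) := \varphi(e^x)$ for all $x \in [-\infty,\infty)$ (with $e^{-\infty} = 0$) is convex and strictly increasing on its domain $[-\infty,\infty)$, and $\psi(\mathbb{R}) \subseteq \mathbb{R}$.
   Context: Let $\mu$ be Lebesgue measure on $\mathbb{R}$ (with the Borel $\sigma$-algebra); all integrals and almost-everywhere statements are with respect to $\mu$. Let $\mathcal{L}_\mu$ be the set of measurable functions $f : \mathbb{R} \to \mathbb{R}$ with $f \ge 0$ and $\int_{\mathbb{R}} f \, d\mu = 1$. For $\alpha > 0$ let $\mathcal{L}_{\mu,\alpha} := \{ f \in \mathcal{L}_\mu : \int_{\mathbb{R}} f^{1+\alpha}\, d\mu < \infty \}$. For $\varphi : [0,\infty) \to [-\infty,\infty]$ and $\alpha > 0$, define for $g, f \in \mathcal{L}_{\mu,\alpha}$ $$\mathrm{FDPD}_{\varphi,\alpha}(g,f) := \varphi\Big(\int_{\mathbb{R}} f^{\alpha+1}\Big) - \Big(1 + \frac{1}{\alpha}\Big)\varphi\Big(\int_{\mathbb{R}} f^{\alpha} g\Big) + \frac{1}{\alpha}\,\varphi\Big(\int_{\mathbb{R}} g^{\alpha+1}\Big).$$ $\mathrm{FDPD}_{\varphi,\alpha}$ is called a valid divergence if this expression is well defined in the extended reals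 (no $\infty - \infty$ occurs) for all $g, f \in \mathcal{L}_{\mu,\alpha}$, takes values in $[0,\infty]$, and satisfies $\mathrm{FDPD}_{\varphi,\alpha}(g,f) = 0 \iff g = f$ a.e. $[\mu]$. Convexity of $\psi$ on $[-\infty,\infty)$ means $\psi(\lambda x + (1-\lambda) y) \le \lambda \psi(x) + (1-\lambda)\psi(y)$ for all $x,y \in [-\infty,\infty)$ and $\lambda \in (0,1)$, with the usual extended-real arithmetic. *)

theory Defs
  imports "HOL-Analysis.Analysis"
begin

definition densities :: "(real \<Rightarrow> real) set" where
  "densities =
     {f. f \<in> borel_measurable lborel \<and> (\<forall>x. 0 \<le> f x) \<and>
         (\<integral>\<^sup>+ x. ennreal (f x) \<partial>lborel) = 1}"

definition power_densities :: "real \<Rightarrow> (real \<Rightarrow> real) set" where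
  "power_densities \<alpha> =
     {f \<in> densities. (\<integral>\<^sup>+ x. ennreal (f x powr (1 + \<alpha>)) \<partial>lborel) < \<infinity>}"

text \<open>For \<open>\<alpha> > 0\<close> all three integrals occurring in the divergence are integrals of integrable
  functions (see \<open>power_densities_integrable\<close> and \<open>power_densities_integrable_cross\<close> below), so
  the convention that the integral of a non-integrable function is \<open>0\<close> plays no role.\<close>

lemma power_densities_integrable:
  assumes "f \<in> power_densities \<alpha>"
  shows "integrable lborel (\<lambda>x. f x powr (\<alpha> + 1))"
proof (rule integrableI_nonneg)
  show "(\<lambda>x. f x powr (\<alpha> + 1)) \<in> borel_measurable lborel"
    using assms by (auto simp: power_densities_def densities_def)
  show "(\<integral>\<^sup>+ x. ennreal (f x powr (\<alpha> + 1)) \<partial>lborel) < \<infinity>"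
    using assms by (simp add: power_densities_def add.commute)
qed simp

lemma power_densities_integrable_cross:
  assumes "\<alpha> > 0" "f \<in> power_densities \<alpha>" "g \<in> power_densities \<alpha>"
  shows "integrable lborel (\<lambda>x. f x powr \<alpha> * g x)"
proof (rule Bochner_Integration.integrable_bound)
  show "integrable lborel (\<lambda>x. f x powr (\<alpha> + 1) + g x powr (\<alpha> + 1))"
    using assms by (intro Bochner_Integration.integrable_add power_densities_integrable)
  show "(\<lambda>x. f x powr \<alpha> * g x) \<in> borel_measurable lborel"
    using assms by (auto simp: power_densities_def densities_def)
  have "a powr \<alpha> * b \<le> a powr (\<alpha> + 1) + b powr (\<alpha> + 1)" if "0 \<le> a" "0 \<le> b" for a b :: real
  proof -
    have "a powr \<alpha> * b \<le> max a b powr \<alpha> * max a b"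
      using that \<open>\<alpha> > 0\<close> by (intro mult_mono powr_mono2) auto
    also have "\<dots> = max a b powr (\<alpha> + 1)"
      using that by (simp add: powr_add)
    also have "\<dots> \<le> a powr (\<alpha> + 1) + b powr (\<alpha> + 1)"
      by (auto simp: max_def)
    finally show ?thesis .
  qed
  then show "AE x in lborel. norm (f x powr \<alpha> * g x)
      \<le> norm (f x powr (\<alpha> + 1) + g x powr (\<alpha> + 1))"
    using assms by (auto simp: power_densities_def densities_def)
qed

text \<open>The function \<open>\<phi>\<close> has domain \<open>[0,\<infinity>)\<close>; its values on negative reals are never used.\<close>

definition FDPD :: "(real \<Rightarrow> ereal) \<Rightarrow> real \<Rightarrow> (real \<Rightarrow> real) \<Rightarrow> (real \<Rightarrow> real) \<Rightarrow> ereal" where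
  "FDPD \<phi> \<alpha> g f =
     \<phi> (\<integral>x. f x powr (\<alpha> + 1) \<partial>lborel)
     - ereal (1 + 1 / \<alpha>) * \<phi> (\<integral>x. f x powr \<alpha> * g x \<partial>lborel)
     + ereal (1 / \<alpha>) * \<phi> (\<integral>x. g x powr (\<alpha> + 1) \<partial>lborel)"

text \<open>HOL assigns \<open>\<infinity> - \<infinity>\<close> a value in \<^typ>\<open>ereal\<close>, so well-definedness of the sum is stated
  separately: its three summands do not include both \<open>\<infinity>\<close> and \<open>-\<infinity>\<close>.\<close>

definition FDPD_well_defined ::
    "(real \<Rightarrow> ereal) \<Rightarrow> real \<Rightarrow> (real \<Rightarrow> real) \<Rightarrow> (real \<Rightarrow> real) \<Rightarrow> bool" where
  "FDPD_well_defined \<phi> \<alpha> g f \<longleftrightarrow>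
     (let S = {\<phi> (\<integral>x. f x powr (\<alpha> + 1) \<partial>lborel),
               - (ereal (1 + 1 / \<alpha>) * \<phi> (\<integral>x. f x powr \<alpha> * g x \<partial>lborel)),
               ereal (1 / \<alpha>) * \<phi> (\<integral>x. g x powr (\<alpha> + 1) \<partial>lborel)}
      in \<not> (\<infinity> \<in> S \<and> - \<infinity> \<in> S))"

definition valid_FDPD :: "(real \<Rightarrow> ereal) \<Rightarrow> real \<Rightarrow> bool" where
  "valid_FDPD \<phi> \<alpha> \<longleftrightarrow>
     (\<forall>g \<in> power_densities \<alpha>. \<forall>f \<in> power_densities \<alpha>.
        FDPD_well_defined \<phi> \<alpha> g f \<and>
        0 \<le> FDPD \<phi> \<alpha> g f \<and>
        (FDPD \<phi> \<alpha> g f = 0 \<longleftrightarrow> (AE x in lborel. g x = f x)))"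

text \<open>The exponential on \<open>[-\<infinity>,\<infinity>)\<close>; the value at \<open>\<infinity>\<close> is irrelevant.\<close>

definition exp_ereal :: "ereal \<Rightarrow> real" where
  "exp_ereal x = (if x = - \<infinity> then 0 else exp (real_of_ereal x))"

text \<open>In \<^typ>\<open>ereal\<close> we have \<open>\<infinity> + (-\<infinity>) = \<infinity>\<close>, so a sum of this form on the right-hand side would
  make the inequality vacuous. It cannot arise when \<open>\<psi>\<close> is strictly increasing on \<open>[-\<infinity>,\<infinity>)\<close>
  and finite on the reals, since then \<open>\<psi> < \<infinity>\<close> there.\<close>

definition convex_below_infinity :: "(ereal \<Rightarrow> ereal) \<Rightarrow> bool" where
  "convex_below_infinity \<psi> \<longleftrightarrow>
     (\<forall>x \<in> {..<\<infinity>}. \<forall>y \<in> {..<\<infinity>}. \<forall>l \<in> {0<..<1::real}.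
        \<psi> (ereal l * x + ereal (1 - l) * y) \<le> ereal l * \<psi> x + ereal (1 - l) * \<psi> y)"

end

theory Submission
  imports Defs
begin

text \<open>
  Write \<open>l = \<alpha> / (\<alpha> + 1)\<close> and \<open>h x = \<phi> (exp x)\<close>. Hoelder's inequality bounds
  \<open>\<integral> f powr \<alpha> * g\<close> by \<open>A powr l * B powr (1 - l)\<close>, where \<open>A = \<integral> f powr (\<alpha> + 1)\<close> and
  \<open>B = \<integral> g powr (\<alpha> + 1)\<close>. The proof rests on the converse fact that nothing else constrains the
  three integrals: every value in \<open>[0, A powr l * B powr (1 - l))\<close> is attained, for arbitrary
  \<open>A, B > 0\<close>, by two densities (\<open>power_densities_realise\<close>). Positivity of the divergence on
  all these pairs says precisely, on the logarithmic scale, that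
    \<open>h w < l * h u + (1 - l) * h v\<close> whenever \<open>w < l * u + (1 - l) * v\<close>,
  and that \<open>\<phi> 0\<close> lies below every \<open>h u\<close> (\<open>valid_FDPD_strict\<close>). Finiteness of \<open>h\<close> comes from
  the pairs \<open>g = f\<close>: there the divergence contains \<open>\<phi> A\<close> with coefficients of both signs.

  The rest is real analysis. The displayed property makes \<open>h\<close> strictly increasing (take
  \<open>u = v\<close>). It says nothing about \<open>w\<close> equal to the mean, so convexity needs continuity, which
  the property itself yields: it makes the oscillation of \<open>h\<close> around a point shrink by the factor
  \<open>1 - l\<close> when the radius shrinks by a fixed factor (\<open>below_mean_continuous\<close>). Then \<open>h\<close> is convex
  for the single weight \<open>l\<close>, and a continuous function with this property is convex for all
  weights (\<open>fixed_weight_convex_imp_convex\<close>).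
\<close>

section \<open>Densities with prescribed power integrals\<close>

text \<open>
  Step densities with two levels suffice: on a core \<open>S\<close> the two densities interact, while a tail
  \<open>T\<close> restores unit mass and fixes the power integral. Taking \<open>r = 1\<close> below gives
  the mass, and \<open>r = \<alpha> + 1\<close> the power integral.
\<close>

lemma two_level_powr:
  fixes S T :: "real set"
  assumes "S \<inter> T = {}" "0 < r"
  shows "(a * indicator S x + e * indicator T x) powr r = a powr r * indicator S x + e powr r * indicator T x"
  using assms by (auto simp: indicator_def)

lemma has_bochner_integral_two_level_powr:
  fixes S T :: "real set"
  assumes "S \<in> sets lborel" "T \<in> sets lborel" "emeasure lborel S < \<infinity>" "emeasure lborel T < \<infinity>"
    and "S \<inter> T = {}" "0 < r"
  shows "has_bochner_integral lborel (\<lambda>x. (a * indicator S x + e * indicator T x) powr r)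
           (a powr r * measure lborel S + e powr r * measure lborel T)"
  unfolding two_level_powr[OF assms(5,6)]
  using assms
  by (intro has_bochner_integral_add has_bochner_integral_mult_right has_bochner_integral_real_indicator) auto

lemma two_level_power_density:
  fixes S T :: "real set"
  assumes "S \<in> sets lborel" "T \<in> sets lborel" "emeasure lborel S < \<infinity>" "emeasure lborel T < \<infinity>"
    and "S \<inter> T = {}" "0 < \<alpha>" "0 \<le> a" "0 \<le> e"
    and mass: "a * measure lborel S + e * measure lborel T = 1"
  shows "(\<lambda>x. a * indicator S x + e * indicator T x) \<in> power_densities \<alpha>"
proof -
  let ?f = "\<lambda>x. a * indicator S x + e * indicator T x :: real"
  have nonneg: "0 \<le> ?f x" for x
    using assms by simp
  have "has_bochner_integral lborel ?f 1"
    using has_bochner_integral_two_level_powr[OF assms(1-5), of 1 a e] nonneg assms by simp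
  then have "(\<integral>\<^sup>+ x. ennreal (?f x) \<partial>lborel) = 1"
    using nonneg by (subst nn_integral_eq_integral) (auto simp: has_bochner_integral_iff)
  moreover have "integrable lborel (\<lambda>x. ?f x powr (1 + \<alpha>))"
    using has_bochner_integral_two_level_powr[OF assms(1-5), of "1 + \<alpha>" a e] assms
    by (auto simp: has_bochner_integral_iff)
  then have "(\<integral>\<^sup>+ x. ennreal (?f x powr (1 + \<alpha>)) \<partial>lborel) < \<infinity>"
    by (subst nn_integral_eq_integral) auto
  moreover have "?f \<in> borel_measurable lborel"
    using assms by measurable
  ultimately show ?thesis
    using nonneg by (simp add: power_densities_def densities_def)
qed

text \<open>
  With height \<open>e\<close> and the mass \<open>m = 1 - a * p\<close> that is still missing, the tail contributes
  \<open>e powr \<alpha> * m\<close> to the power integral. Because \<open>\<alpha> > 0\<close>, this takes every positive value as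
  \<open>e\<close> varies, so unit mass costs no freedom: low, long tails carry much mass but little power.
\<close>

lemma tail_exists:
  fixes A :: real
  assumes "0 < \<alpha>" "a * p < 1" "a powr (\<alpha> + 1) * p < A"
  obtains e q where "0 < e" "0 < q" "a * p + e * q = 1"
    "a powr (\<alpha> + 1) * p + e powr (\<alpha> + 1) * q = A"
proof -
  define m where "m = 1 - a * p"
  define e where "e = ((A - a powr (\<alpha> + 1) * p) / m) powr (1 / \<alpha>)"
  have m: "0 < m" using assms by (simp add: m_def)
  have quot: "0 < (A - a powr (\<alpha> + 1) * p) / m" using m assms by simp
  then have e: "0 < e" unfolding e_def powr_gt_zero by (metis less_irrefl)
  have "e powr \<alpha> = (A - a powr (\<alpha> + 1) * p) / m"
    using quot m assms by (simp add: e_def powr_powr)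
  then have "e powr (\<alpha> + 1) * (m / e) = A - a powr (\<alpha> + 1) * p"
    using e m by (simp add: powr_add)
  then show ?thesis
    using that[of e "m / e"] e m by (simp add: m_def)
qed

text \<open>
  Two densities that share the core \<open>[0, p)\<close>, with tails on opposite sides of it. The tails are
  invisible to the mixed integral, which is therefore determined by the core alone.
\<close>

lemma power_densities_common_core:
  fixes A B :: real
  assumes "0 < \<alpha>" "0 < p"
    and a: "0 \<le> a" "a * p < 1" "a powr (\<alpha> + 1) * p < A"
    and b: "0 \<le> b" "b * p < 1" "b powr (\<alpha> + 1) * p < B"
  shows "\<exists>f\<in>power_densities \<alpha>. \<exists>g\<in>power_densities \<alpha>.
     (\<integral>x. f x powr (\<alpha> + 1) \<partial>lborel) = A \<and> (\<integral>x. g x powr (\<alpha> + 1) \<partial>lborel) = B \<and>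
     (\<integral>x. f x powr \<alpha> * g x \<partial>lborel) = a powr \<alpha> * b * p"
proof -
  obtain e q where e: "0 < e" "0 < q" "a * p + e * q = 1"
    "a powr (\<alpha> + 1) * p + e powr (\<alpha> + 1) * q = A"
    using tail_exists[OF assms(1) a(2,3)] by blast
  obtain e' q' where e': "0 < e'" "0 < q'" "b * p + e' * q' = 1"
    "b powr (\<alpha> + 1) * p + e' powr (\<alpha> + 1) * q' = B"
    using tail_exists[OF assms(1) b(2,3)] by blast
  let ?S = "{0..<p}" and ?T = "{p..<p + q}" and ?T' = "{- q'..<0}"
  let ?f = "\<lambda>x. a * indicator ?S x + e * indicator ?T x :: real"
  let ?g = "\<lambda>x. b * indicator ?S x + e' * indicator ?T' x :: real"
  have "?f \<in> power_densities \<alpha>"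
    using assms e by (intro two_level_power_density) auto
  moreover have "?g \<in> power_densities \<alpha>"
    using assms e' by (intro two_level_power_density) auto
  moreover have "(\<integral>x. ?f x powr (\<alpha> + 1) \<partial>lborel) = A"
    using has_bochner_integral_two_level_powr[of ?S ?T "\<alpha> + 1" a e] assms e
    by (auto simp: has_bochner_integral_iff)
  moreover have "(\<integral>x. ?g x powr (\<alpha> + 1) \<partial>lborel) = B"
    using has_bochner_integral_two_level_powr[of ?S ?T' "\<alpha> + 1" b e'] assms e'
    by (auto simp: has_bochner_integral_iff)
  moreover have "(\<lambda>x. ?f x powr \<alpha> * ?g x) = (\<lambda>x. a powr \<alpha> * b * indicator ?S x)"
    using assms e e' by (auto simp: indicator_def fun_eq_iff)
  then have "(\<integral>x. ?f x powr \<alpha> * ?g x \<partial>lborel) = a powr \<alpha> * b * p"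
    using assms by simp
  ultimately show ?thesis
    by - (intro bexI[of _ ?f] bexI[of _ ?g] conjI)
qed

text \<open>
  Both cores are given the fraction \<open>\<theta>\<close> of the prescribed power integral. On the core the two
  densities are proportional, so Hoelder's inequality is an equality there, and the mixed integral
  is \<open>\<theta>\<close> times Hoelder's bound.
\<close>

lemma power_densities_realise:
  fixes A B :: real
  assumes \<alpha>: "0 < \<alpha>" and A: "0 < A" and B: "0 < B" and \<theta>: "0 \<le> \<theta>" "\<theta> < 1"
  shows "\<exists>f\<in>power_densities \<alpha>. \<exists>g\<in>power_densities \<alpha>.
     (\<integral>x. f x powr (\<alpha> + 1) \<partial>lborel) = A \<and> (\<integral>x. g x powr (\<alpha> + 1) \<partial>lborel) = B \<and>
     (\<integral>x. f x powr \<alpha> * g x \<partial>lborel) = \<theta> * (A powr (\<alpha> / (\<alpha> + 1)) * B powr (1 / (\<alpha> + 1)))"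
proof -
  \<comment> \<open>A core of width \<open>p\<close> with power integral \<open>\<theta> * M\<close> has height \<open>h M\<close>. Its mass is
    \<open>(\<theta> * M * p powr \<alpha>) powr (1 / (\<alpha> + 1))\<close>; the width is chosen to keep this below \<open>1\<close> for
    \<open>M = A\<close> and \<open>M = B\<close> alike.\<close>
  define p where "p = (1 / (A + B)) powr (1 / \<alpha>)"
  define h where "h = (\<lambda>M. (\<theta> * M / p) powr (1 / (\<alpha> + 1)))"
  have p: "0 < p" using A B by (simp add: p_def)
  have p_\<alpha>: "p powr \<alpha> = 1 / (A + B)" using A B \<alpha> by (simp add: p_def powr_powr)
  have h_pow: "h M powr (\<alpha> + 1) * p = \<theta> * M" if "0 < M" for M
    using that p \<theta> \<alpha> by (simp add: h_def powr_powr)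
  have h_mass: "h M * p < 1" if "0 < M" "M \<le> A + B" for M
  proof (rule ccontr)
    assume "\<not> h M * p < 1"
    then have "1 \<le> (h M * p) powr (\<alpha> + 1)" using \<alpha> by (intro ge_one_powr_ge_zero) auto
    also have "\<dots> = h M powr (\<alpha> + 1) * p * p powr \<alpha>"
      using p by (simp add: h_def powr_mult powr_add)
    also have "\<dots> = \<theta> * (M / (A + B))" using h_pow[OF that(1)] p_\<alpha> by simp
    also have "\<dots> \<le> \<theta>"
      using that A B \<theta> by (intro mult_left_le) auto
    also note \<open>\<theta> < 1\<close>
    finally show False by simp
  qed
  have h_lt: "h M powr (\<alpha> + 1) * p < M" if "0 < M" for M
    using h_pow[OF that] that \<theta> by simp
  have "h A powr \<alpha> * h B * p
      = (\<theta> / p) powr (\<alpha> / (\<alpha> + 1)) * (\<theta> / p) powr (1 / (\<alpha> + 1)) * p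
        * (A powr (\<alpha> / (\<alpha> + 1)) * B powr (1 / (\<alpha> + 1)))"
    using A B p \<theta> by (simp add: h_def powr_powr powr_mult powr_divide)
  also have "(\<theta> / p) powr (\<alpha> / (\<alpha> + 1)) * (\<theta> / p) powr (1 / (\<alpha> + 1)) * p = \<theta>"
    using \<alpha> p \<theta> by (simp flip: powr_add add_divide_distrib)
  finally show ?thesis
    using power_densities_common_core[OF \<alpha> p _ h_mass[OF A] h_lt[OF A] _ h_mass[OF B] h_lt[OF B]] A B
    by (simp add: h_def)
qed

section \<open>Functions that lie below a weighted mean left of the mean point\<close>

lemma below_mean_strict_mono:
  fixes h :: "real \<Rightarrow> real"
  assumes below: "\<And>u v w. w < l * u + (1 - l) * v \<Longrightarrow> h w < l * h u + (1 - l) * h v"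
  shows "strict_mono h"
proof (rule strict_monoI)
  fix x y :: real assume "x < y"
  then show "h x < h y"
    using below[of x y y] by (simp add: algebra_simps)
qed

text \<open>
  For small \<open>c\<close> the point \<open>x + c * d\<close> lies left of the weighted mean of \<open>x - c * d\<close> and
  \<open>x + d\<close>. This bounds the increment \<open>D (c * d)\<close> of \<open>h\<close> over the interval of radius \<open>c * d\<close>
  around \<open>x\<close> by \<open>1 - l\<close> times the increment \<open>D d\<close>. So the increments decay geometrically, and as
  \<open>h\<close> is monotone they control its oscillation.
\<close>

lemma below_mean_continuous:
  fixes h :: "real \<Rightarrow> real"
  assumes l: "0 < l" "l < 1"
    and below: "\<And>u v w. w < l * u + (1 - l) * v \<Longrightarrow> h w < l * h u + (1 - l) * h v"
  shows "isCont h x"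
proof -
  have mono: "h s \<le> h t" if "s \<le> t" for s t
    using below_mean_strict_mono[OF below] that by (simp add: strict_mono_less_eq)
  \<comment> \<open>The mean of \<open>x - c * d\<close> and \<open>x + d\<close> exceeds \<open>x + c * d\<close> iff \<open>c * (1 + l) < 1 - l\<close>; half of
    \<open>1 - l\<close> is enough because \<open>l < 1\<close>.\<close>
  define c where "c = (1 - l) / 2"
  define D where "D = (\<lambda>d. h (x + d) - h (x - d))"
  have c: "0 < c" using l by (simp add: c_def)
  have D_step: "D (c * d) \<le> (1 - l) * D d" if d: "0 < d" for d
  proof -
    have "(1 - l) * d * ((1 + l) / 2) < (1 - l) * d * 1"
      using l d by (intro mult_strict_left_mono) auto
    then have "x + c * d < l * (x - c * d) + (1 - l) * (x + d)"
      by (simp add: c_def field_simps)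
    from below[OF this]
    have "h (x + c * d) - h (x - c * d) \<le> (1 - l) * (h (x + d) - h (x - c * d))"
      by (simp add: algebra_simps)
    also have "\<dots> \<le> (1 - l) * (h (x + d) - h (x - d))"
    proof -
      have "c * d \<le> 1 * d" using l d by (intro mult_right_mono) (auto simp: c_def)
      then have "h (x - d) \<le> h (x - c * d)" by (intro mono) simp
      then show ?thesis using l by (intro mult_left_mono) auto
    qed
    finally show ?thesis by (simp add: D_def)
  qed
  have D_pow: "D (c ^ n) \<le> (1 - l) ^ n * D 1" for n
  proof (induction n)
    case (Suc n)
    have "D (c ^ Suc n) \<le> (1 - l) * D (c ^ n)"
      using D_step[of "c ^ n"] c by simp
    also have "\<dots> \<le> (1 - l) * ((1 - l) ^ n * D 1)"
      using l by (intro mult_left_mono Suc) auto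
    finally show ?case by simp
  qed simp
  have lim: "(\<lambda>n. (1 - l) ^ n * D 1) \<longlonglongrightarrow> 0"
    using l by (intro tendsto_mult_left_zero LIMSEQ_realpow_zero) auto
  show ?thesis
    unfolding continuous_at_eps_delta
  proof (intro allI impI)
    fix e :: real assume "0 < e"
    then obtain n where n: "(1 - l) ^ n * D 1 < e"
      using order_tendstoD(2)[OF lim] by (metis eventually_sequentially order_refl)
    have "dist (h y) (h x) < e" if "dist y x < c ^ n" for y
    proof -
      have "h y \<le> h (x + c ^ n)" "h (x - c ^ n) \<le> h y"
           "h x \<le> h (x + c ^ n)" "h (x - c ^ n) \<le> h x"
        using that c by (auto intro!: mono simp: dist_real_def)
      then show ?thesis
        using D_pow[of n] n by (simp add: D_def dist_real_def)
    qed
    then show "\<exists>d>0. \<forall>y. dist y x < d \<longrightarrow> dist (h y) (h x) < e"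
      using c by (intro exI[of _ "c ^ n"]) simp
  qed
qed

text \<open>
  If \<open>h\<close> rises above a chord, then the difference \<open>k\<close> of \<open>h\<close> and the chord has a positive maximum
  in the interior of \<open>[0, 1]\<close>. Its smallest maximiser \<open>s\<close> is a mean with weights \<open>l\<close> and
  \<open>1 - l\<close> of a point left of \<open>s\<close>, where \<open>k\<close> is strictly smaller, and a point right of \<open>s\<close>, where
  it is not larger. This contradicts convexity of \<open>k\<close> for the weight \<open>l\<close>.
\<close>

lemma fixed_weight_convex_imp_convex:
  fixes h :: "real \<Rightarrow> real"
  assumes l: "0 < l" "l < 1" and cont: "continuous_on UNIV h"
    and conv: "\<And>u v. h (l * u + (1 - l) * v) \<le> l * h u + (1 - l) * h v"
  shows "convex_on UNIV h"
proof (rule convex_onI)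
  fix t x y :: real assume t: "0 < t" "t < 1"
  define k where "k = (\<lambda>s. h ((1 - s) * x + s * y) - ((1 - s) * h x + s * h y))"
  have k_conv: "k (l * s + (1 - l) * s') \<le> l * k s + (1 - l) * k s'" for s s'
    using conv[of "(1 - s) * x + s * y" "(1 - s') * x + s' * y"]
    by (simp add: k_def algebra_simps)
  have k_cont: "continuous_on S k" for S
    unfolding k_def
    by (intro continuous_intros continuous_on_compose2[OF cont]) auto
  have "k t \<le> 0"
  proof (rule ccontr)
    assume "\<not> k t \<le> 0"
    have "\<exists>m\<in>{0..1}. \<forall>s\<in>{0..1}. k s \<le> k m"
      by (intro continuous_attains_sup k_cont) auto
    then obtain m where m: "m \<in> {0..1}" "\<And>s. s \<in> {0..1} \<Longrightarrow> k s \<le> k m" by blast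
    let ?M = "{s \<in> {0..1}. k s = k m}"
    have "closed ?M"
      by (intro continuous_closed_preimage_constant k_cont) auto
    then have "compact ?M"
      unfolding compact_eq_bounded_closed by (auto intro: bounded_subset[of "{0..1}"])
    then obtain s where s: "s \<in> ?M" "\<And>s'. s' \<in> ?M \<Longrightarrow> s \<le> s'"
      using compact_attains_inf[of ?M] m(1) by auto
    have pos: "0 < k s"
      using s(1) m(2)[of t] t \<open>\<not> k t \<le> 0\<close> by auto
    then have s01: "0 < s" "s < 1"
      using s(1) by (auto simp: k_def less_le)
    define d where "d = min s (1 - s)"
    have d: "0 < d" "d \<le> s" "d \<le> 1 - s"
      using s01 by (auto simp: d_def)
    have ld: "0 < (1 - l) * d" "(1 - l) * d \<le> d" "0 < l * d" "l * d \<le> d"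
      using l d by (simp_all add: mult_le_cancel_right1)
    let ?a = "s - (1 - l) * d" and ?b = "s + l * d"
    have ab: "?a \<in> {0..1}" "?b \<in> {0..1}" "?a < s"
      unfolding atLeastAtMost_iff using ld d by ((intro conjI)?; linarith)+
    have "k ?a < k m"
      using m(2)[OF ab(1)] s(2)[of ?a] ab by force
    moreover have "k ?b \<le> k m" by (rule m(2)[OF ab(2)])
    ultimately have "l * k ?a + (1 - l) * k ?b < l * k m + (1 - l) * k m"
      using l by (intro add_less_le_mono mult_strict_left_mono mult_left_mono) auto
    moreover have "l * ?a + (1 - l) * ?b = s" by (simp add: algebra_simps)
    ultimately show False
      using k_conv[of ?a ?b] s(1) by (simp add: algebra_simps)
  qed
  then show "h ((1 - t) *\<^sub>R x + t *\<^sub>R y) \<le> (1 - t) * h x + t * h y"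
    by (simp add: k_def)
qed simp

text \<open>
  By continuity the bound on the left of the mean point persists, as a weak inequality, at
  the point itself.
\<close>

lemma below_mean_convex:
  fixes h :: "real \<Rightarrow> real"
  assumes l: "0 < l" "l < 1"
    and below: "\<And>u v w. w < l * u + (1 - l) * v \<Longrightarrow> h w < l * h u + (1 - l) * h v"
  shows "convex_on UNIV h"
proof (rule fixed_weight_convex_imp_convex[OF l])
  show cont: "continuous_on UNIV h"
    using below_mean_continuous[OF l below] by (simp add: continuous_on_eq_continuous_at)
  fix u v
  let ?m = "l * u + (1 - l) * v"
  have "(h \<longlongrightarrow> h ?m) (at_left ?m)"
    using below_mean_continuous[where h = h and x = ?m, OF l below]
    by (simp add: isCont_def filterlim_at_split)
  moreover have "\<forall>\<^sub>F w in at_left ?m. h w \<le> l * h u + (1 - l) * h v"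
    using below by (auto simp: eventually_at_filter intro!: always_eventually less_imp_le)
  ultimately show "h ?m \<le> l * h u + (1 - l) * h v"
    by (intro tendsto_upperbound) auto
qed

section \<open>Consequences of a valid divergence\<close>

text \<open>
  For \<open>g = f\<close> all three arguments of \<open>\<phi>\<close> are equal, but the middle coefficient is negative, so an
  infinite value of \<open>\<phi>\<close> would produce \<open>\<infinity> - \<infinity>\<close>.
\<close>

lemma valid_FDPD_finite:
  assumes \<alpha>: "0 < \<alpha>" and valid: "valid_FDPD \<phi> \<alpha>" and A: "0 < A"
  shows "\<bar>\<phi> A\<bar> \<noteq> \<infinity>"
proof -
  obtain f where f: "f \<in> power_densities \<alpha>" "(\<integral>x. f x powr (\<alpha> + 1) \<partial>lborel) = A"
    using power_densities_realise[OF \<alpha> A A, of 0] by auto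
  have "f x powr \<alpha> * f x = f x powr (\<alpha> + 1)" for x
    using f(1) by (auto simp: power_densities_def densities_def powr_add)
  then have "(\<integral>x. f x powr \<alpha> * f x \<partial>lborel) = A" using f(2) by simp
  moreover have "FDPD_well_defined \<phi> \<alpha> f f"
    using valid f(1) by (simp add: valid_FDPD_def)
  moreover have "0 < 1 + 1 / \<alpha>" using \<alpha> by (simp add: add_pos_pos)
  ultimately show ?thesis
    using f(2) by (cases "\<phi> A") (simp_all add: FDPD_well_defined_def)
qed

text \<open>
  The densities realising the factor \<open>\<theta> < 1\<close> miss Hoelder's bound, so they differ on a set of
  positive measure and their divergence is strictly positive. The case \<open>\<theta> = 0\<close> concerns \<open>\<phi> 0\<close>,
  the only value of \<open>\<phi>\<close> here that may be \<open>-\<infinity>\<close>.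
\<close>

lemma valid_FDPD_strict:
  assumes \<alpha>: "0 < \<alpha>" and valid: "valid_FDPD \<phi> \<alpha>" and A: "0 < A" and B: "0 < B"
    and \<theta>: "0 \<le> \<theta>" "\<theta> < 1"
  shows "\<phi> (\<theta> * (A powr (\<alpha> / (\<alpha> + 1)) * B powr (1 / (\<alpha> + 1))))
       < ereal (\<alpha> / (\<alpha> + 1)) * \<phi> A + ereal (1 / (\<alpha> + 1)) * \<phi> B"
proof -
  let ?C = "\<theta> * (A powr (\<alpha> / (\<alpha> + 1)) * B powr (1 / (\<alpha> + 1)))"
  obtain f g where f: "f \<in> power_densities \<alpha>" and g: "g \<in> power_densities \<alpha>"
    and int: "(\<integral>x. f x powr (\<alpha> + 1) \<partial>lborel) = A" "(\<integral>x. g x powr (\<alpha> + 1) \<partial>lborel) = B"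
      "(\<integral>x. f x powr \<alpha> * g x \<partial>lborel) = ?C"
    using power_densities_realise[OF \<alpha> A B \<theta>] by blast
  have meas: "f \<in> borel_measurable lborel" "g \<in> borel_measurable lborel" "\<And>x. 0 \<le> f x"
    using f g by (auto simp: power_densities_def densities_def)
  have "\<not> (AE x in lborel. g x = f x)"
  proof
    assume eq: "AE x in lborel. g x = f x"
    have "(\<integral>x. g x powr (\<alpha> + 1) \<partial>lborel) = (\<integral>x. f x powr (\<alpha> + 1) \<partial>lborel)"
      using eq meas by (intro integral_cong_AE) auto
    then have "B = A" using int by simp
    have "(\<integral>x. f x powr \<alpha> * g x \<partial>lborel) = (\<integral>x. f x powr (\<alpha> + 1) \<partial>lborel)"
      using eq meas by (intro integral_cong_AE) (auto simp: powr_add)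
    then have "?C = A" using int by simp
    moreover have "A powr (\<alpha> / (\<alpha> + 1)) * A powr (1 / (\<alpha> + 1)) = A"
      using \<alpha> A by (simp flip: powr_add add_divide_distrib)
    ultimately show False
      using \<open>B = A\<close> A \<theta> by simp
  qed
  with valid f g have wd: "FDPD_well_defined \<phi> \<alpha> g f" and pos: "0 < FDPD \<phi> \<alpha> g f"
    by (auto simp: valid_FDPD_def less_le)
  obtain a where a: "\<phi> A = ereal a" using valid_FDPD_finite[OF \<alpha> valid A] by auto
  obtain b where b: "\<phi> B = ereal b" using valid_FDPD_finite[OF \<alpha> valid B] by auto
  have coeff: "0 < 1 + 1 / \<alpha>" using \<alpha> by (simp add: add_pos_pos)
  show ?thesis
  proof (cases "\<phi> ?C")
    case (real c)
    have "0 < a - (1 + 1 / \<alpha>) * c + 1 / \<alpha> * b"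
      using pos by (simp add: FDPD_def int a b real)
    then have "c * (\<alpha> + 1) < \<alpha> * a + b"
      using \<alpha> by (simp add: field_simps)
    then have "c < (\<alpha> * a + b) / (\<alpha> + 1)"
      using \<alpha> by (simp add: pos_less_divide_eq)
    then show ?thesis by (simp add: a b real add_divide_distrib)
  next
    case PInf
    then show ?thesis
      using pos coeff by (simp add: FDPD_def int a b)
  qed (simp add: a b)
qed

theorem proposition2:
  fixes \<alpha> :: real and \<phi> :: "real \<Rightarrow> ereal" and \<psi> :: "ereal \<Rightarrow> ereal"
  assumes "0 < \<alpha>"
    and "valid_FDPD \<phi> \<alpha>"
    and "\<And>x. x < \<infinity> \<Longrightarrow> \<psi> x = \<phi> (exp_ereal x)"
  shows "convex_below_infinity \<psi> \<and> strict_mono_on {..<\<infinity>} \<psi> \<and> \<psi> ` range ereal \<subseteq> range ereal"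
proof -
  note \<alpha> = assms(1)
  define h where "h = (\<lambda>x. real_of_ereal (\<phi> (exp x)))"
  define l where "l = \<alpha> / (\<alpha> + 1)"
  have l: "0 < l" "l < 1" and l': "1 - l = 1 / (\<alpha> + 1)"
    using \<alpha> by (auto simp: l_def field_simps)
  have \<phi>_exp: "\<phi> (exp x) = ereal (h x)" for x
    using valid_FDPD_finite[OF assms(1,2), of "exp x"] by (simp add: h_def ereal_real)
  have \<psi>_real: "\<psi> (ereal x) = ereal (h x)" for x
    using assms(3) \<phi>_exp by (simp add: exp_ereal_def)
  have \<psi>_MInf: "\<psi> (-\<infinity>) = \<phi> 0"
    using assms(3) by (simp add: exp_ereal_def)

  \<comment> \<open>On the logarithmic scale Hoelder's bound is the mean \<open>l * u + (1 - l) * v\<close>, and the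
    factor \<open>\<theta>\<close> is the exponential of the distance by which \<open>w\<close> falls short of it.\<close>
  have below: "h w < l * h u + (1 - l) * h v" if w: "w < l * u + (1 - l) * v" for u v w
  proof -
    define \<theta> where "\<theta> = exp (w - (l * u + (1 - l) * v))"
    have "\<theta> * (exp u powr l * exp v powr (1 - l)) = exp w"
      by (simp add: \<theta>_def powr_def exp_diff exp_add)
    then show ?thesis
      using valid_FDPD_strict[OF assms(1,2), of "exp u" "exp v" \<theta>] w
      by (simp add: \<theta>_def \<phi>_exp flip: l_def l')
  qed
  have mono: "h x < h y \<longleftrightarrow> x < y" for x y
    using below_mean_strict_mono[OF below] by (rule strict_mono_less)
  have convex: "convex_on UNIV h"
    by (rule below_mean_convex[OF l below])

  have bottom: "\<phi> 0 < ereal (h y)" for y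
  proof -
    have "\<phi> 0 < ereal l * ereal (h y) + ereal (1 - l) * ereal (h y)"
      using valid_FDPD_strict[OF assms(1,2), of "exp y" "exp y" 0]
      by (simp add: \<phi>_exp flip: l_def l')
    then show ?thesis by (simp add: algebra_simps)
  qed

  have "strict_mono_on {..<\<infinity>} \<psi>"
  proof (rule strict_mono_onI)
    fix x y :: ereal assume "x \<in> {..<\<infinity>}" "y \<in> {..<\<infinity>}" "x < y"
    then show "\<psi> x < \<psi> y"
      by (cases x; cases y) (auto simp: \<psi>_real \<psi>_MInf mono bottom)
  qed
  moreover have "convex_below_infinity \<psi>"
    unfolding convex_below_infinity_def
  proof (intro ballI)
    fix x y :: ereal and t :: real
    assume x: "x \<in> {..<\<infinity>}" and y: "y \<in> {..<\<infinity>}" and "t \<in> {0<..<1}"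
    then have t: "0 < t" "t < 1" by auto
    \<comment> \<open>A mean with an endpoint \<open>-\<infinity>\<close> is again \<open>-\<infinity>\<close>, so there convexity only compares \<open>\<phi> 0\<close> with
      larger values.\<close>
    have at_bottom: "\<phi> 0 \<le> ereal s * \<phi> 0 + ereal (1 - s) * ereal (h z)" if "0 < s" "s < 1" for s z
    proof (cases "\<phi> 0")
      case (real c)
      then have "(1 - s) * c \<le> (1 - s) * h z"
        using bottom[of z] that by (intro mult_left_mono) auto
      then show ?thesis using real by (simp add: algebra_simps)
    qed (use bottom[of z] that in auto)
    have at_bottom2: "\<phi> 0 \<le> ereal t * \<phi> 0 + ereal (1 - t) * \<phi> 0"
      using bottom[of 0] t by (cases "\<phi> 0") (auto simp: algebra_simps)
    show "\<psi> (ereal t * x + ereal (1 - t) * y) \<le> ereal t * \<psi> x + ereal (1 - t) * \<psi> y"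
    proof (cases x)
      case x_real: (real r)
      show ?thesis
      proof (cases y)
        case (real s)
        have "h (t * r + (1 - t) * s) \<le> t * h r + (1 - t) * h s"
          using convex_onD[OF convex, of "1 - t" r s] t by simp
        then show ?thesis by (simp add: real x_real \<psi>_real)
      next
        case MInf
        then show ?thesis
          using at_bottom[of "1 - t" r] t by (simp add: x_real \<psi>_real \<psi>_MInf add.commute)
      qed (use y in simp)
    next
      case x_MInf: MInf
      show ?thesis
      proof (cases y)
        case (real s)
        then show ?thesis
          using at_bottom[of t s] t by (simp add: x_MInf \<psi>_real \<psi>_MInf)
      next
        case MInf
        then show ?thesis
          using at_bottom2 t by (simp add: x_MInf \<psi>_MInf)
      qed (use y in simp)
    qed (use x in simp)
  qed
  moreover have "\<psi> ` range ereal \<subseteq> range ereal"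
    by (intro image_subsetI) (metis \<psi>_real rangeE rangeI)
  ultimately show ?thesis by blast
qed

end
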